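(* Let $N$ be a finite set with $|N|\geq 2$ and let $u\in\mathbb{R}^{\mathcal{P}(N)}$. Then the following two conditions are equivalent. (i) There exists a real vector $\eta=(\eta(i|B))_{i\in N,\,B\subseteq N\setminus\{i\}}$ such that $\eta(i|B)\geq 0$ for all $i\in N$, $B\subseteq N\setminus\{i\}$; $\sum_{B\subseteq N\setminus\{j\}}\eta(j|B)=1$ for all $j\in N$; and $u^{\eta}(T)=u(T)$ for every $T\subseteq N$. (ii) $\sum_{T\subseteq N}u(T)=0$; $\sum_{T\subseteq N,\,j\in T}u(T)=0$ for every $j\in N$; and $\sum_{T\in\mathcal{A}}u(T)\leq 1$ for every non-empty class $\mathcal{A}$ of non-empty subsets of $N$ which is closed under supersets.
   Context: $\mathcal{P}(N)$ is the power set of $N$. For $A\subseteq N$, $\delta_A(S)=1$ if $S=A$ and $\delta_A(S)=0$ for $S\subseteq N$, $S\neq A$. A class $\mathcal{A}$ of subsets of $N$ is closed under supersets if $S\in\mathcal{A}$, $S\subseteq T\subseteq N$ implies $T\in\mathcal{A}$. For a vector $\eta=(\eta(i|B))_{i\in N,\,B\subseteq N\setminus\{i\}}$, the vector $u^{\eta}\in\mathbb{R}^{\mathcal{P}(N)}$ is given for $T\subseteq N$ by $$u^{\eta}(T)=\delta_N(T)-\delta_{\emptyset}(T)+\sum_{i\in N}\sum_{B\subseteq N\setminus\{i\}}\eta(i|B)\cdot\{\delta_B(T)-\delta_{\{i\}\cup B}(T)\}.$$ *)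

theory Defs
  imports Complex_Main
begin

text \<open>
  Vectors indexed by subsets of \<open>N\<close> are functions \<open>'a set \<Rightarrow> real\<close> of which only the values on
  \<open>Pow N\<close> matter; the component \<open>\<eta>(i|B)\<close> is written \<open>\<eta> i B\<close>, and only its values for \<open>i \<in> N\<close>,
  \<open>B \<subseteq> N - {i}\<close> matter.
\<close>

definition delta :: "'a set \<Rightarrow> 'a set \<Rightarrow> real" where
  "delta A S = (if S = A then 1 else 0)"

definition u_eta :: "'a set \<Rightarrow> ('a \<Rightarrow> 'a set \<Rightarrow> real) \<Rightarrow> 'a set \<Rightarrow> real" where
  "u_eta N \<eta> T = delta N T - delta {} T
     + (\<Sum>i\<in>N. \<Sum>B\<in>Pow (N - {i}). \<eta> i B * (delta B T - delta ({i} \<union> B) T))"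

definition closed_under_supersets :: "'a set \<Rightarrow> 'a set set \<Rightarrow> bool" where
  "closed_under_supersets N \<A> \<longleftrightarrow> (\<forall>S T. S \<in> \<A> \<longrightarrow> S \<subseteq> T \<longrightarrow> T \<subseteq> N \<longrightarrow> T \<in> \<A>)"

end

theory Submission
  imports Defs
begin

text \<open>
  Regard the power set of \<open>N\<close> as a directed graph with an edge from \<open>B\<close> to \<open>{i} \<union> B\<close> whenever
  \<open>i \<in> N\<close> and \<open>B \<subseteq> N - {i}\<close>, and \<open>\<eta>(i|B)\<close> as the amount of a flow along this edge.  The double sum
  in \<open>u_eta\<close> is then the net outflow of \<open>\<eta>\<close> at \<open>T\<close>, so condition (i) asks for a non-negative flow
  whose net outflow is \<open>w = u - \<delta>\<^sub>N + \<delta>\<^sub>\<emptyset>\<close> and which sends one unit in total along the edges of each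
  direction \<open>j\<close>.

  Summing the net outflow over a class \<open>\<A>\<close> leaves only the edges that leave or enter \<open>\<A>\<close>
  (\<open>sum_u_eta\<close>).  No edge leaves a class closed under supersets, which gives the inequalities in (ii).
  The class of all sets containing \<open>j\<close> is entered exactly by the edges of direction \<open>j\<close>, so the sum
  of \<open>u\<close> over that class vanishes if and only if these edges carry one unit in total.

  Conversely, the first and the third part of (ii) say that \<open>w\<close> has total \<open>0\<close> and is non-positive in
  sum on every class that no edge leaves: a class that contains \<open>\<emptyset>\<close> and that no edge leaves is the
  whole power set.  By a feasibility theorem of Gale's type for flows without capacity bounds
  (\<open>flow_cone_if_closed_sums_nonpos\<close>), \<open>w\<close> is then the net outflow of a non-negative flow.
\<close>

section \<open>Net outflows of non-negative flows on a digraph\<close>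

text \<open>
  Only net outflows matter for feasibility.  They form the convex cone generated by the vectors of
  the edges, and working in this cone avoids choosing a flow in every step of the proof below.
\<close>
definition shipment :: "'b \<Rightarrow> 'b \<Rightarrow> 'b \<Rightarrow> real" where
  "shipment x y z = of_bool (z = x) - of_bool (z = y)"

inductive_set flow_cone :: "('b \<times> 'b) set \<Rightarrow> ('b \<Rightarrow> real) set" for E where
  zero: "(\<lambda>_. 0) \<in> flow_cone E"
| edge: "(x, y) \<in> E \<Longrightarrow> c \<ge> 0 \<Longrightarrow> (\<lambda>z. c * shipment x y z) \<in> flow_cone E"
| add: "f \<in> flow_cone E \<Longrightarrow> g \<in> flow_cone E \<Longrightarrow> (\<lambda>z. f z + g z) \<in> flow_cone E"

lemma flow_cone_mono:
  assumes "f \<in> flow_cone E" and "E \<subseteq> E'"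
  shows "f \<in> flow_cone E'"
  using assms by (induction rule: flow_cone.induct) (auto intro: flow_cone.intros)

lemma flow_cone_path:
  assumes "(x, y) \<in> E\<^sup>*" and "c \<ge> 0"
  shows "(\<lambda>z. c * shipment x y z) \<in> flow_cone E"
  using assms(1)
proof (induction rule: rtrancl_induct)
  case base
  then show ?case
    using flow_cone.zero by (simp add: shipment_def)
next
  case (step y z)
  have "(\<lambda>v. c * shipment x z v) = (\<lambda>v. c * shipment x y v + c * shipment y z v)"
    by (simp add: shipment_def algebra_simps)
  then show ?case
    using flow_cone.add[OF step.IH flow_cone.edge[OF step.hyps(2) assms(2)]] by simp
qed

lemma sum_shipment:
  assumes "finite A"
  shows "(\<Sum>z\<in>A. shipment x y z) = of_bool (x \<in> A) - of_bool (y \<in> A)"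
  using assms by (simp add: shipment_def sum_subtractf of_bool_def sum.delta)

text \<open>
  A set with \<open>E `` A \<inter> V \<subseteq> A\<close> can only receive flow, so the condition is necessary; here is why it
  suffices.  From a vertex \<open>x\<close> with surplus, ship to a reachable vertex \<open>y\<close> with deficit as much as
  the surplus, the deficit and the condition permit; such a \<open>y\<close> exists since the set of all vertices
  reachable from \<open>x\<close> is closed.  Either \<open>x\<close> or \<open>y\<close> becomes balanced, or some closed set
  \<open>A\<close> containing \<open>y\<close> but not \<open>x\<close> becomes tight.  In the latter case the problem falls apart into
  independent problems on \<open>A\<close> and on \<open>V - A\<close>: a set closed within \<open>A\<close> is closed within \<open>V\<close>, and a set
  closed within \<open>V - A\<close> becomes closed within \<open>V\<close> when the tight set \<open>A\<close> is added.  In both cases the number of vertices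
  plus the number of unbalanced vertices decreases.
\<close>
theorem flow_cone_if_closed_sums_nonpos:
  fixes w :: "'b \<Rightarrow> real"
  assumes "finite V"
    and "\<And>v. v \<notin> V \<Longrightarrow> w v = 0"
    and "sum w V = 0"
    and "\<And>A. A \<subseteq> V \<Longrightarrow> E `` A \<inter> V \<subseteq> A \<Longrightarrow> sum w A \<le> 0"
  shows "w \<in> flow_cone (Restr E V)"
  using assms
proof (induction "card V + card {v \<in> V. w v \<noteq> 0}" arbitrary: V w rule: less_induct)
  case less
  note fin = \<open>finite V\<close> and supp = less.prems(2) and total = less.prems(3)
    and closed_nonpos = less.prems(4)
  have finA: "finite A" if "A \<subseteq> V" for A
    using that fin finite_subset by blast
  show ?case
  proof (cases "\<forall>v\<in>V. w v = 0")
    case True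
    then have "w = (\<lambda>_. 0)"
      using supp by auto
    then show ?thesis
      using flow_cone.zero by simp
  next
    case False
    have "\<exists>x\<in>V. w x > 0"
    proof (rule ccontr)
      assume "\<not> (\<exists>x\<in>V. w x > 0)"
      then have "\<forall>x\<in>V. - w x \<ge> 0"
        by auto
      moreover have "(\<Sum>x\<in>V. - w x) = 0"
        using total by (simp add: sum_negf)
      ultimately show False
        using False sum_nonneg_eq_0_iff[OF fin, of "\<lambda>x. - w x"] by auto
    qed
    then obtain x where x: "x \<in> V" "w x > 0"
      by blast
    define R where "R = (Restr E V)\<^sup>* `` {x}"
    have "z \<in> V" if "(x, z) \<in> (Restr E V)\<^sup>*" for z
      using that x(1) by (induction rule: rtrancl_induct) auto
    then have RV: "R \<subseteq> V"
      by (auto simp: R_def)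
    have "E `` R \<inter> V \<subseteq> R"
      using RV by (auto simp: R_def intro: rtrancl_into_rtrancl)
    then have "sum w R \<le> 0"
      using RV closed_nonpos by blast
    moreover have "x \<in> R"
      by (simp add: R_def)
    ultimately have "\<exists>y\<in>R. w y < 0"
      using sum_pos2[OF finA[OF RV], of x w] x(2) by force
    then obtain y where y: "y \<in> R" "w y < 0"
      by blast
    have yV: "y \<in> V" and xy: "x \<noteq> y" and path: "(x, y) \<in> (Restr E V)\<^sup>*"
      using y x(2) RV by (auto simp: R_def)

    \<comment> \<open>Shipping from \<open>x\<close> to \<open>y\<close> raises only the sums over closed sets that contain \<open>y\<close> but not \<open>x\<close>.\<close>
    define S where "S = {A. A \<subseteq> V \<and> E `` A \<inter> V \<subseteq> A \<and> y \<in> A \<and> x \<notin> A}"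
    define slacks where "slacks = {w x, - w y} \<union> (\<lambda>A. - sum w A) ` S"
    define c where "c = Min slacks"
    have "S \<subseteq> Pow V"
      by (auto simp: S_def)
    then have slacks_fin: "finite slacks"
      using fin by (auto simp: slacks_def intro: finite_subset)
    have c_le: "c \<le> s" if "s \<in> slacks" for s
      using that slacks_fin by (simp add: c_def)
    have c_in: "c \<in> slacks"
      unfolding c_def by (rule Min_in[OF slacks_fin]) (simp add: slacks_def)
    have "s \<ge> 0" if "s \<in> slacks" for s
    proof -
      have "sum w A \<le> 0" if "A \<in> S" for A
        using that closed_nonpos[of A] unfolding S_def by blast
      then show ?thesis
        using that x(2) y(2) by (auto simp: slacks_def)
    qed
    then have c_nonneg: "c \<ge> 0"
      using c_in by blast

    define w' where "w' z = w z - c * shipment x y z" for z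
    have w_eq: "w = (\<lambda>z. c * shipment x y z + w' z)"
      by (simp add: w'_def)
    have sum_w': "sum w' A = sum w A - c * (of_bool (x \<in> A) - of_bool (y \<in> A))" if "A \<subseteq> V" for A
      unfolding w'_def sum_subtractf sum_distrib_left[symmetric] sum_shipment[OF finA[OF that]] ..
    have supp': "w' v = 0" if "v \<notin> V" for v
      using that supp x(1) yV by (auto simp: w'_def shipment_def)
    have total': "sum w' V = 0"
      using sum_w'[of V] total x(1) yV by simp
    have nonpos': "sum w' A \<le> 0" if A: "A \<subseteq> V" "E `` A \<inter> V \<subseteq> A" for A
    proof (cases "y \<in> A \<and> x \<notin> A")
      case True
      then have "c \<le> - sum w A"
        using A by (intro c_le) (auto simp: slacks_def S_def)
      then show ?thesis
        using True sum_w'[OF A(1)] by simp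
    next
      case False
      then show ?thesis
        using closed_nonpos[OF A] c_nonneg sum_w'[OF A(1)] by (auto simp: of_bool_def)
    qed
    have nonzero': "{v \<in> V. w' v \<noteq> 0} \<subseteq> {v \<in> V. w v \<noteq> 0}"
      using x(2) y(2) by (auto simp: w'_def shipment_def)

    have "w' \<in> flow_cone (Restr E V)"
    proof (cases "w' x = 0 \<or> w' y = 0")
      case True
      then obtain z where "z \<in> V" "w z \<noteq> 0" "w' z = 0"
        using x yV y(2) by (metis less_irrefl)
      then have "{v \<in> V. w' v \<noteq> 0} \<subset> {v \<in> V. w v \<noteq> 0}"
        using nonzero' by auto
      then have "card {v \<in> V. w' v \<noteq> 0} < card {v \<in> V. w v \<noteq> 0}"
        using fin by (intro psubset_card_mono) auto
      then have "card V + card {v \<in> V. w' v \<noteq> 0} < card V + card {v \<in> V. w v \<noteq> 0}"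
        by simp
      then show ?thesis
        using fin supp' total' nonpos' by (rule less.hyps)
    next
      case False
      then have "c \<noteq> w x" "c \<noteq> - w y"
        using xy by (auto simp: w'_def shipment_def)
      then obtain A where A: "A \<in> S" "c = - sum w A"
        using c_in by (auto simp: slacks_def)
      have AV: "A \<subseteq> V" and A_closed: "E `` A \<inter> V \<subseteq> A" and yA: "y \<in> A" and xA: "x \<notin> A"
        using A(1) by (auto simp: S_def)
      have tight: "sum w' A = 0"
        using sum_w'[OF AV] yA xA A(2) by simp

      have part: "(\<lambda>v. if v \<in> U then w' v else 0) \<in> flow_cone (Restr E V)"
        if U: "U \<subset> V" and tot: "sum w' U = 0"
          and nonpos: "\<And>B. B \<subseteq> U \<Longrightarrow> E `` B \<inter> U \<subseteq> B \<Longrightarrow> sum w' B \<le> 0" for U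
      proof -
        let ?f = "\<lambda>v. if v \<in> U then w' v else 0"
        have sum_f: "sum ?f B = sum w' B" if "B \<subseteq> U" for B
          using that by (intro sum.cong) auto
        have "card U < card V"
          using U fin by (simp add: psubset_card_mono)
        moreover have "card {v \<in> U. ?f v \<noteq> 0} \<le> card {v \<in> V. w v \<noteq> 0}"
          using U nonzero' fin by (intro card_mono) auto
        ultimately have "card U + card {v \<in> U. ?f v \<noteq> 0} < card V + card {v \<in> V. w v \<noteq> 0}"
          by simp
        then have "?f \<in> flow_cone (Restr E U)"
        proof (rule less.hyps)
          show "finite U"
            using U finA by blast
          show "sum ?f U = 0"
            using sum_f[of U] tot by simp
          show "sum ?f B \<le> 0" if "B \<subseteq> U" "E `` B \<inter> U \<subseteq> B" for B
            using sum_f[OF that(1)] nonpos[OF that] by simp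
        qed simp
        then show ?thesis
          by (rule flow_cone_mono) (use U in auto)
      qed

      have "(\<lambda>v. if v \<in> A then w' v else 0) \<in> flow_cone (Restr E V)"
      proof (rule part)
        show "A \<subset> V"
          using AV x(1) xA by blast
        show "sum w' B \<le> 0" if B: "B \<subseteq> A" "E `` B \<inter> A \<subseteq> B" for B
        proof (rule nonpos')
          show "B \<subseteq> V"
            using B AV by blast
          show "E `` B \<inter> V \<subseteq> B"
            using B A_closed by blast
        qed
      qed (rule tight)
      moreover have "(\<lambda>v. if v \<in> V - A then w' v else 0) \<in> flow_cone (Restr E V)"
      proof (rule part)
        show "V - A \<subset> V"
          using AV yA by blast
        show "sum w' (V - A) = 0"
          using AV fin tight total' by (simp add: sum_diff)
        show "sum w' B \<le> 0" if B: "B \<subseteq> V - A" "E `` B \<inter> (V - A) \<subseteq> B" for B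
        proof -
          have "sum w' (B \<union> A) = sum w' B + sum w' A"
            using B AV by (intro sum.union_disjoint finA) auto
          moreover have "sum w' (B \<union> A) \<le> 0"
          proof (rule nonpos')
            show "B \<union> A \<subseteq> V"
              using B AV by blast
            show "E `` (B \<union> A) \<inter> V \<subseteq> B \<union> A"
              using B A_closed by blast
          qed
          ultimately show ?thesis
            using tight by simp
        qed
      qed
      ultimately have
        "(\<lambda>v. (if v \<in> A then w' v else 0) + (if v \<in> V - A then w' v else 0)) \<in> flow_cone (Restr E V)"
        by (rule flow_cone.add)
      moreover have "w' = (\<lambda>v. (if v \<in> A then w' v else 0) + (if v \<in> V - A then w' v else 0))"
        using supp' AV by auto
      ultimately show ?thesis
        by simp
    qed
    then show ?thesis
      using flow_cone.add[OF flow_cone_path[OF path c_nonneg]] w_eq by simp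
  qed
qed

section \<open>The hypercube\<close>
definition hypercube :: "'a set \<Rightarrow> ('a set \<times> 'a set) set" where
  "hypercube N = {(B, {i} \<union> B) | i B. i \<in> N \<and> B \<subseteq> N - {i}}"

lemma closed_under_supersets_if_hypercube_closed:
  assumes "finite N" and "hypercube N `` \<A> \<inter> Pow N \<subseteq> \<A>"
  shows "closed_under_supersets N \<A>"
proof -
  have "S \<union> D \<in> \<A>" if "S \<in> \<A>" "S \<subseteq> N" "D \<subseteq> N" "finite D" for S D
    using that(4,3)
  proof (induction rule: finite_induct)
    case empty
    then show ?case
      using that by simp
  next
    case (insert i D)
    show ?case
    proof (cases "i \<in> S")
      case True
      then show ?thesis
        using insert by (simp add: insert_absorb)
    next
      case False
      then have "(S \<union> D, S \<union> insert i D) \<in> hypercube N"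
        using insert that(2) unfolding hypercube_def by auto
      then show ?thesis
        using insert that(2) assms(2) by blast
    qed
  qed
  then show ?thesis
    unfolding closed_under_supersets_def
    by (metis assms(1) finite_subset order.trans sup.absorb2)
qed

text \<open>A single edge is realised by an \<open>\<eta>\<close> with a single non-zero entry, and sums by sums.\<close>
lemma flow_cone_hypercube_obtain_eta:
  assumes "finite N" and "w \<in> flow_cone (hypercube N)"
  obtains \<eta> :: "'a \<Rightarrow> 'a set \<Rightarrow> real"
  where "\<And>i B. \<eta> i B \<ge> 0"
    and "\<And>T. w T = (\<Sum>i\<in>N. \<Sum>B\<in>Pow (N - {i}). \<eta> i B * (delta B T - delta ({i} \<union> B) T))"
proof -
  let ?out = "\<lambda>\<eta> T. \<Sum>i\<in>N. \<Sum>B\<in>Pow (N - {i}). \<eta> i B * (delta B T - delta ({i} \<union> B) T)"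
  have "\<exists>\<eta> :: 'a \<Rightarrow> 'a set \<Rightarrow> real. (\<forall>i B. \<eta> i B \<ge> 0) \<and> (\<forall>T. w T = ?out \<eta> T)"
    using assms(2)
  proof (induction rule: flow_cone.induct)
    case zero
    show ?case
      by (rule exI[of _ "\<lambda>_ _. 0"]) simp
  next
    case (edge X Y c)
    then obtain j where j: "j \<in> N" "X \<subseteq> N - {j}" "Y = {j} \<union> X"
      by (auto simp: hypercube_def)
    define \<eta> where "\<eta> i B = (if i = j then if B = X then c else 0 else 0)" for i B
    have "?out \<eta> T = c * shipment X Y T" for T
    proof -
      have "(\<Sum>B\<in>Pow (N - {i}). \<eta> i B * (delta B T - delta ({i} \<union> B) T)) =
          (if i = j then c * shipment X Y T else 0)" for i
      proof (cases "i = j")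
        case True
        have "(\<Sum>B\<in>Pow (N - {j}). \<eta> j B * (delta B T - delta ({j} \<union> B) T)) =
            (\<Sum>B\<in>Pow (N - {j}). if B = X then c * (delta B T - delta ({j} \<union> B) T) else 0)"
          by (intro sum.cong) (auto simp: \<eta>_def)
        also have "\<dots> = c * (delta X T - delta ({j} \<union> X) T)"
          using j assms(1) by (subst sum.delta) auto
        finally show ?thesis
          using True j by (simp add: shipment_def delta_def of_bool_def)
      qed (simp add: \<eta>_def)
      then show ?thesis
        using j assms(1) by (simp add: sum.delta)
    qed
    then show ?case
      using edge by (intro exI[of _ \<eta>]) (auto simp: \<eta>_def)
  next
    case (add f g)
    then obtain \<eta> \<theta> :: "'a \<Rightarrow> 'a set \<Rightarrow> real"
      where "\<forall>i B. \<eta> i B \<ge> 0" "\<forall>T. f T = ?out \<eta> T" "\<forall>i B. \<theta> i B \<ge> 0" "\<forall>T. g T = ?out \<theta> T"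
      by blast
    then show ?case
      by (intro exI[of _ "\<lambda>i B. \<eta> i B + \<theta> i B"]) (simp add: distrib_right sum.distrib)
  qed
  then show thesis
    using that by blast
qed

section \<open>The equivalence\<close>

lemma sum_u_eta:
  assumes "finite \<A>"
  shows "(\<Sum>T\<in>\<A>. u_eta N \<eta> T) = of_bool (N \<in> \<A>) - of_bool ({} \<in> \<A>)
    + (\<Sum>i\<in>N. \<Sum>B\<in>Pow (N - {i}). \<eta> i B * (of_bool (B \<in> \<A>) - of_bool ({i} \<union> B \<in> \<A>)))"
proof -
  have d: "(\<Sum>T\<in>\<A>. delta B T) = of_bool (B \<in> \<A>)" for B
    using assms by (simp add: delta_def sum.delta)
  have "(\<Sum>T\<in>\<A>. \<Sum>i\<in>N. \<Sum>B\<in>Pow (N - {i}). \<eta> i B * (delta B T - delta ({i} \<union> B) T)) =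
      (\<Sum>i\<in>N. \<Sum>B\<in>Pow (N - {i}). \<Sum>T\<in>\<A>. \<eta> i B * (delta B T - delta ({i} \<union> B) T))"
    by (simp only: sum.swap[where A = \<A>])
  also have "\<dots> =
      (\<Sum>i\<in>N. \<Sum>B\<in>Pow (N - {i}). \<eta> i B * (of_bool (B \<in> \<A>) - of_bool ({i} \<union> B \<in> \<A>)))"
    by (simp only: sum_subtractf d flip: sum_distrib_left)
  finally show ?thesis
    by (simp only: u_eta_def sum.distrib sum_subtractf d)
qed

lemma sum_u_eta_Pow:
  assumes "finite N"
  shows "(\<Sum>T\<in>Pow N. u_eta N \<eta> T) = 0"
proof -
  have "(\<Sum>i\<in>N. \<Sum>B\<in>Pow (N - {i}).
      \<eta> i B * (of_bool (B \<in> Pow N) - of_bool ({i} \<union> B \<in> Pow N))) = 0"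
    by (intro sum.neutral ballI) auto
  then show ?thesis
    using assms by (subst sum_u_eta) auto
qed

text \<open>
  Adding an element \<open>i \<noteq> j\<close> to \<open>B\<close> does not change whether \<open>j\<close> belongs to it, so among the edges only
  those of direction \<open>j\<close> contribute.
\<close>
lemma sum_u_eta_containing:
  assumes "finite N" and "j \<in> N"
  shows "(\<Sum>T | T \<subseteq> N \<and> j \<in> T. u_eta N \<eta> T) = 1 - (\<Sum>B\<in>Pow (N - {j}). \<eta> j B)"
proof -
  let ?\<A> = "{T. T \<subseteq> N \<and> j \<in> T}"
  have "(\<Sum>B\<in>Pow (N - {i}). \<eta> i B * (of_bool (B \<in> ?\<A>) - of_bool ({i} \<union> B \<in> ?\<A>))) =
      (if i = j then - (\<Sum>B\<in>Pow (N - {j}). \<eta> j B) else 0)" if "i \<in> N" for i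
  proof (cases "i = j")
    case True
    have "(\<Sum>B\<in>Pow (N - {j}). \<eta> j B * (of_bool (B \<in> ?\<A>) - of_bool ({j} \<union> B \<in> ?\<A>))) =
        (\<Sum>B\<in>Pow (N - {j}). - \<eta> j B)"
      using assms(2) by (intro sum.cong) auto
    then show ?thesis
      using True by (simp add: sum_negf)
  next
    case False
    then show ?thesis
      using that by (auto intro!: sum.neutral)
  qed
  then have "(\<Sum>i\<in>N. \<Sum>B\<in>Pow (N - {i}).
        \<eta> i B * (of_bool (B \<in> ?\<A>) - of_bool ({i} \<union> B \<in> ?\<A>))) =
      (\<Sum>i\<in>N. if i = j then - (\<Sum>B\<in>Pow (N - {j}). \<eta> j B) else 0)"
    by (intro sum.cong) auto
  also have "\<dots> = - (\<Sum>B\<in>Pow (N - {j}). \<eta> j B)"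
    using assms by (simp add: sum.delta)
  finally show ?thesis
    using assms by (subst sum_u_eta) auto
qed

lemma sum_u_eta_le_1:
  assumes "finite N" and nonneg: "\<And>i B. i \<in> N \<Longrightarrow> B \<subseteq> N - {i} \<Longrightarrow> \<eta> i B \<ge> 0"
    and "\<A> \<subseteq> Pow N" and closed: "closed_under_supersets N \<A>"
  shows "(\<Sum>T\<in>\<A>. u_eta N \<eta> T) \<le> 1"
proof -
  have "(\<Sum>i\<in>N. \<Sum>B\<in>Pow (N - {i}).
      \<eta> i B * (of_bool (B \<in> \<A>) - of_bool ({i} \<union> B \<in> \<A>))) \<le> 0"
  proof (intro sum_nonpos)
    fix i B
    assume i: "i \<in> N" and B: "B \<in> Pow (N - {i})"
    have "{i} \<union> B \<in> \<A>" if "B \<in> \<A>"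
    proof -
      have "{i} \<union> B \<subseteq> N" "B \<subseteq> {i} \<union> B"
        using i B by auto
      then show ?thesis
        using that closed unfolding closed_under_supersets_def by blast
    qed
    then have "of_bool (B \<in> \<A>) - of_bool ({i} \<union> B \<in> \<A>) \<le> (0::real)"
      by (simp add: of_bool_def)
    then show "\<eta> i B * (of_bool (B \<in> \<A>) - of_bool ({i} \<union> B \<in> \<A>)) \<le> 0"
      using nonneg i B by (intro mult_nonneg_nonpos) auto
  qed
  moreover have "of_bool (N \<in> \<A>) - of_bool ({} \<in> \<A>) \<le> (1::real)"
    by (simp add: of_bool_def)
  moreover have "finite \<A>"
    using assms(1,3) by (meson finite_Pow_iff finite_subset)
  ultimately show ?thesis
    by (subst sum_u_eta) auto
qed

text \<open>
  Feasibility of the flow problem for \<open>w = u - \<delta>\<^sub>N + \<delta>\<^sub>\<emptyset>\<close>.  The total amount that the flow sends in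
  direction \<open>j\<close> is afterwards determined by \<open>sum_u_eta_containing\<close>.
\<close>
lemma obtain_eta_if_superset_closed_sums_le_1:
  fixes u :: "'a set \<Rightarrow> real"
  assumes "finite N"
    and total: "(\<Sum>T\<in>Pow N. u T) = 0"
    and le_1: "\<And>\<A>. \<A> \<noteq> {} \<Longrightarrow> \<A> \<subseteq> Pow N - {{}} \<Longrightarrow> closed_under_supersets N \<A>
      \<Longrightarrow> (\<Sum>T\<in>\<A>. u T) \<le> 1"
  obtains \<eta> :: "'a \<Rightarrow> 'a set \<Rightarrow> real"
  where "\<And>i B. \<eta> i B \<ge> 0" and "\<And>T. T \<subseteq> N \<Longrightarrow> u_eta N \<eta> T = u T"
proof -
  define w where "w T = (if T \<subseteq> N then u T - delta N T + delta {} T else 0)" for T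
  have sum_w: "sum w \<A> = sum u \<A> - of_bool (N \<in> \<A>) + of_bool ({} \<in> \<A>)" if "\<A> \<subseteq> Pow N" for \<A>
  proof -
    have "finite \<A>"
      using that assms(1) by (meson finite_Pow_iff finite_subset)
    then have d: "(\<Sum>T\<in>\<A>. delta B T) = of_bool (B \<in> \<A>)" for B
      by (simp add: delta_def sum.delta)
    have "sum w \<A> = (\<Sum>T\<in>\<A>. u T - delta N T + delta {} T)"
      using that by (intro sum.cong) (auto simp: w_def)
    then show ?thesis
      by (simp add: sum.distrib sum_subtractf d)
  qed
  have "w \<in> flow_cone (Restr (hypercube N) (Pow N))"
  proof (rule flow_cone_if_closed_sums_nonpos)
    show "finite (Pow N)"
      using assms(1) by simp
    show "w T = 0" if "T \<notin> Pow N" for T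
      using that by (simp add: w_def)
    show total_w: "sum w (Pow N) = 0"
      using total by (simp add: sum_w)
    show "sum w \<A> \<le> 0" if \<A>: "\<A> \<subseteq> Pow N" "hypercube N `` \<A> \<inter> Pow N \<subseteq> \<A>" for \<A>
    proof -
      have closed: "closed_under_supersets N \<A>"
        using closed_under_supersets_if_hypercube_closed assms(1) \<A>(2) .
      consider "\<A> = {}" | "{} \<in> \<A>" | "\<A> \<noteq> {}" "{} \<notin> \<A>"
        by blast
      then show ?thesis
      proof cases
        case 1
        then show ?thesis
          by simp
      next
        case 2
        then have "\<A> = Pow N"
          using \<A>(1) closed unfolding closed_under_supersets_def by blast
        then show ?thesis
          using total_w by simp
      next
        case 3
        then have "sum u \<A> \<le> 1"
          using le_1 closed \<A>(1) by blast
        moreover have "N \<in> \<A>"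
          using 3 \<A>(1) closed unfolding closed_under_supersets_def by blast
        ultimately show ?thesis
          using 3 by (simp add: sum_w[OF \<A>(1)])
      qed
    qed
  qed
  then have "w \<in> flow_cone (hypercube N)"
    by (rule flow_cone_mono) auto
  then obtain \<eta> :: "'a \<Rightarrow> 'a set \<Rightarrow> real"
    where \<eta>: "\<And>i B. \<eta> i B \<ge> 0"
      and w: "\<And>T. w T = (\<Sum>i\<in>N. \<Sum>B\<in>Pow (N - {i}). \<eta> i B * (delta B T - delta ({i} \<union> B) T))"
    using flow_cone_hypercube_obtain_eta[OF assms(1)] by blast
  have "u_eta N \<eta> T = u T" if "T \<subseteq> N" for T
    using that by (simp only: u_eta_def flip: w) (simp add: w_def)
  then show thesis
    using that \<eta> by blast
qed

theorem corollary11: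
  fixes N :: "'a set" and u :: "'a set \<Rightarrow> real"
  assumes "finite N" and "card N \<ge> 2"
  shows
    "(\<exists>\<eta> :: 'a \<Rightarrow> 'a set \<Rightarrow> real.
        (\<forall>i\<in>N. \<forall>B\<in>Pow (N - {i}). \<eta> i B \<ge> 0) \<and>
        (\<forall>j\<in>N. (\<Sum>B\<in>Pow (N - {j}). \<eta> j B) = 1) \<and>
        (\<forall>T\<in>Pow N. u_eta N \<eta> T = u T))
     \<longleftrightarrow>
     ((\<Sum>T\<in>Pow N. u T) = 0 \<and>
      (\<forall>j\<in>N. (\<Sum>T | T \<subseteq> N \<and> j \<in> T. u T) = 0) \<and>
      (\<forall>\<A>. \<A> \<noteq> {} \<and> \<A> \<subseteq> Pow N - {{}} \<and> closed_under_supersets N \<A>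
          \<longrightarrow> (\<Sum>T\<in>\<A>. u T) \<le> 1))"
    (is "?i \<longleftrightarrow> ?ii")
proof
  assume ?i
  then obtain \<eta> :: "'a \<Rightarrow> 'a set \<Rightarrow> real"
    where nonneg: "\<And>i B. i \<in> N \<Longrightarrow> B \<subseteq> N - {i} \<Longrightarrow> \<eta> i B \<ge> 0"
      and one: "\<And>j. j \<in> N \<Longrightarrow> (\<Sum>B\<in>Pow (N - {j}). \<eta> j B) = 1"
      and u: "\<And>T. T \<subseteq> N \<Longrightarrow> u_eta N \<eta> T = u T"
    by (metis Pow_iff)
  have sum_u: "(\<Sum>T\<in>\<A>. u T) = (\<Sum>T\<in>\<A>. u_eta N \<eta> T)" if "\<A> \<subseteq> Pow N" for \<A>
    using that by (intro sum.cong) (auto simp: u)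
  show ?ii
  proof (intro conjI ballI allI impI)
    show "(\<Sum>T\<in>Pow N. u T) = 0"
      using sum_u[of "Pow N"] sum_u_eta_Pow[OF assms(1)] by simp
    show "(\<Sum>T | T \<subseteq> N \<and> j \<in> T. u T) = 0" if "j \<in> N" for j
      using sum_u[of "{T. T \<subseteq> N \<and> j \<in> T}"] sum_u_eta_containing[OF assms(1) that] one[OF that]
      by auto
    show "(\<Sum>T\<in>\<A>. u T) \<le> 1"
      if "\<A> \<noteq> {} \<and> \<A> \<subseteq> Pow N - {{}} \<and> closed_under_supersets N \<A>" for \<A>
    proof -
      have \<A>: "\<A> \<subseteq> Pow N" "closed_under_supersets N \<A>"
        using that by auto
      show ?thesis
        unfolding sum_u[OF \<A>(1)] by (rule sum_u_eta_le_1[OF assms(1) nonneg \<A>])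
    qed
  qed
next
  assume ii: ?ii
  have total: "(\<Sum>T\<in>Pow N. u T) = 0"
    using ii by (elim conjE)
  have containing: "(\<Sum>T | T \<subseteq> N \<and> j \<in> T. u T) = 0" if "j \<in> N" for j
    using ii that by (elim conjE bspec)
  have le_1: "(\<Sum>T\<in>\<A>. u T) \<le> 1"
    if "\<A> \<noteq> {}" "\<A> \<subseteq> Pow N - {{}}" "closed_under_supersets N \<A>" for \<A>
    using ii that by (elim conjE allE[of _ \<A>] impE) auto
  obtain \<eta> :: "'a \<Rightarrow> 'a set \<Rightarrow> real"
    where \<eta>: "\<And>i B. \<eta> i B \<ge> 0" and u: "\<And>T. T \<subseteq> N \<Longrightarrow> u_eta N \<eta> T = u T"
    using obtain_eta_if_superset_closed_sums_le_1[OF assms(1) total le_1] by blast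
  have "(\<Sum>B\<in>Pow (N - {j}). \<eta> j B) = 1" if "j \<in> N" for j
  proof -
    have "(\<Sum>T | T \<subseteq> N \<and> j \<in> T. u_eta N \<eta> T) = (\<Sum>T | T \<subseteq> N \<and> j \<in> T. u T)"
      using u by (intro sum.cong) auto
    then show ?thesis
      using sum_u_eta_containing[OF assms(1) that, of \<eta>] containing[OF that] by simp
  qed
  then show ?i
    using \<eta> u by blast
qed

end
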